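(* Let $A\in\mathbb{R}^{m\times n}$, $b\in\mathbb{R}^m$ and $\ell,u\in\mathbb{R}^n$ with $\ell\le0\le u$, and consider the ResQPASS iteration described in the context. Let $\lambda_k,\mu_k\in\mathbb{R}^n$ be the Lagrange multipliers solving the projected KKT conditions at iteration $k$, and let $V_k\in\mathbb{R}^{n\times k}$ be the basis generated by the residuals. Then there exists an iteration $0<k_0\le n$ such that $$-\lambda_k+\mu_k\in\mathrm{span}\big([V_{k_0},\,A^TAV_{k_0-1}]\big)\quad\text{for all iterations }k\ge k_0 .$$
   Context: ResQPASS iteration: inequalities between vectors are componentwise. Start with $x_0=0$, $\lambda_0=\mu_0=0$, $r_0=-A^Tb$. For $k\ge1$ let $V_k\in\mathbb{R}^{n\times k}$ be the matrix with columns $v_j=r_{j-1}/\|r_{j-1}\|_2$, $j=1,\dots,k$ (iterations are considered only as long as the residuals $r_0,\dots,r_{k-1}$ are nonzero, so that $V_k$ is defined; $V_0$ is the empty matrix). Let $x_k=V_ky_k$ where $y_k\in\mathbb{R}^k$ solves $\min_{y}\frac12\|AV_ky-b\|_2^2$ s.t. $\ell\le V_ky\le u$, and let $\lambda_k,\mu_k\in\mathbb{R}^n$ be associated Lagrange multipliers of the lower and upper bounds, i.e. the projected KKT conditions hold: $V_k^TA^T(AV_ky_k-b)-V_k^T\lambda_k+V_k^T\mu_k=0$; $(\lambda_k)_i([V_ky_k]_i-\ell_i)=0$ and $(\mu_k)_i(u_i-[V_ky_k]_i)=0$ for all $i$; $\ell\le V_ky_k\le u$; $\lambda_k,\mu_k\ge0$.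 Then set $r_k=A^T(Ax_k-b)-\lambda_k+\mu_k$. For a block matrix, $\mathrm{span}([X,Y])$ denotes the span of all columns of $X$ and $Y$.
   Formalization: k0 is only an index with 0 < k0 ≤ n and need not be an iteration that takes place: if the residual vanishes before iteration n, the claim may hold vacuously; requiring k0 to take place would be false, e.g. when A^T b = 0. *)

theory Defs
  imports "HOL-Analysis.Analysis"
begin

text \<open>
  The dimension \<open>k\<close> of \<open>V\<^sub>k\<close> changes during the iteration, so \<open>V\<^sub>k\<close> is given by its columns, numbered
  from 1, and a vector in \<open>\<real>\<^sup>k\<close> is a function of which only the values at \<open>1, \<dots>, k\<close> matter.
  Throughout, \<open>r\<close> is the sequence of residuals; \<open>\<le>\<close> on \<^typ>\<open>real ^ 'n\<close> is componentwise.
\<close>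

definition basis_vec :: "(nat \<Rightarrow> real ^ 'n) \<Rightarrow> nat \<Rightarrow> real ^ 'n"
  where "basis_vec r j = r (j - 1) /\<^sub>R norm (r (j - 1))"

definition V_columns :: "(nat \<Rightarrow> real ^ 'n) \<Rightarrow> nat \<Rightarrow> (real ^ 'n) set"
  where "V_columns r k = basis_vec r ` {1..k}"

text \<open>The products \<open>V\<^sub>k z\<close> and \<open>V\<^sub>k\<^sup>T w\<close>.\<close>

definition V_mult :: "(nat \<Rightarrow> real ^ 'n) \<Rightarrow> nat \<Rightarrow> (nat \<Rightarrow> real) \<Rightarrow> real ^ 'n"
  where "V_mult r k z = (\<Sum>j = 1..k. z j *\<^sub>R basis_vec r j)"

definition Vt_mult :: "(nat \<Rightarrow> real ^ 'n) \<Rightarrow> nat \<Rightarrow> real ^ 'n \<Rightarrow> nat \<Rightarrow> real"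
  where "Vt_mult r k w j = (if j \<in> {1..k} then basis_vec r j \<bullet> w else 0)"

text \<open>Iteration \<open>k\<close> takes place iff \<open>V\<^sub>k\<close> is defined, i.e. no earlier residual vanishes.\<close>

definition is_iteration :: "(nat \<Rightarrow> real ^ 'n) \<Rightarrow> nat \<Rightarrow> bool"
  where "is_iteration r k \<longleftrightarrow> (\<forall>j<k. r j \<noteq> 0)"

definition projected_solution ::
    "real ^ 'n ^ 'm \<Rightarrow> real ^ 'm \<Rightarrow> real ^ 'n \<Rightarrow> real ^ 'n \<Rightarrow> (nat \<Rightarrow> real ^ 'n) \<Rightarrow> nat
      \<Rightarrow> (nat \<Rightarrow> real) \<Rightarrow> bool"
  where "projected_solution A b l u r k y \<longleftrightarrow>
    is_arg_min (\<lambda>z. 1/2 * (norm (A *v V_mult r k z - b))\<^sup>2)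
      (\<lambda>z. l \<le> V_mult r k z \<and> V_mult r k z \<le> u) y"

definition projected_KKT ::
    "real ^ 'n ^ 'm \<Rightarrow> real ^ 'm \<Rightarrow> real ^ 'n \<Rightarrow> real ^ 'n \<Rightarrow> (nat \<Rightarrow> real ^ 'n) \<Rightarrow> nat
      \<Rightarrow> (nat \<Rightarrow> real) \<Rightarrow> real ^ 'n \<Rightarrow> real ^ 'n \<Rightarrow> bool"
  where "projected_KKT A b l u r k y lam mu \<longleftrightarrow>
    (\<forall>j\<in>{1..k}. Vt_mult r k (transpose A *v (A *v V_mult r k y - b)) j
        - Vt_mult r k lam j + Vt_mult r k mu j = 0) \<and>
    (\<forall>i. lam $ i * (V_mult r k y $ i - l $ i) = 0) \<and>
    (\<forall>i. mu $ i * (u $ i - V_mult r k y $ i) = 0) \<and>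
    l \<le> V_mult r k y \<and> V_mult r k y \<le> u \<and>
    0 \<le> lam \<and> 0 \<le> mu"

text \<open>
  All sequences are total; their values are unconstrained at indices \<open>k\<close> at which no iteration takes
  place. The multipliers need not be unique, so a run involves a choice of them.
\<close>

definition ResQPASS ::
    "real ^ 'n ^ 'm \<Rightarrow> real ^ 'm \<Rightarrow> real ^ 'n \<Rightarrow> real ^ 'n \<Rightarrow> (nat \<Rightarrow> nat \<Rightarrow> real)
      \<Rightarrow> (nat \<Rightarrow> real ^ 'n) \<Rightarrow> (nat \<Rightarrow> real ^ 'n) \<Rightarrow> (nat \<Rightarrow> real ^ 'n) \<Rightarrow> (nat \<Rightarrow> real ^ 'n) \<Rightarrow> bool"
  where "ResQPASS A b l u y x lam mu r \<longleftrightarrow>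
    x 0 = 0 \<and> lam 0 = 0 \<and> mu 0 = 0 \<and> r 0 = - (transpose A *v b) \<and>
    (\<forall>k\<ge>1. is_iteration r k \<longrightarrow>
      x k = V_mult r k (y k) \<and>
      projected_solution A b l u r k (y k) \<and>
      projected_KKT A b l u r k (y k) (lam k) (mu k) \<and>
      r k = transpose A *v (A *v x k - b) - lam k + mu k)"

end

theory Submission
  imports Defs
begin

text \<open>
  The index \<open>k\<^sub>0 = n\<close> works. The first projected KKT equation says \<open>V\<^sub>k\<^sup>T r\<^sub>k = 0\<close>, so each residual
  is orthogonal to all earlier ones and the columns of \<open>V\<^sub>k\<close> are orthonormal. If some iteration
  \<open>k \<ge> n\<close> takes place, then \<open>r\<^sub>0, \<dots>, r\<^bsub>n-1\<^esub>\<close> are nonzero, hence the columns of \<open>V\<^sub>n\<close> are an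
  orthonormal basis of \<open>\<real>\<^sup>n\<close> and their span already contains every vector. If the method stops
  earlier, there is no iteration \<open>k \<ge> n\<close> for which anything has to be shown.
\<close>

lemma basis_vec_orthogonal_residual:
  assumes "ResQPASS A b l u y x lam mu r" and "is_iteration r k" and "j \<in> {1..k}"
  shows "basis_vec r j \<bullet> r k = 0"
proof -
  have x: "x k = V_mult r k (y k)"
    and kkt: "projected_KKT A b l u r k (y k) (lam k) (mu k)"
    and r: "r k = transpose A *v (A *v x k - b) - lam k + mu k"
    using assms unfolding ResQPASS_def by auto
  have "Vt_mult r k (transpose A *v (A *v x k - b)) j - Vt_mult r k (lam k) j
      + Vt_mult r k (mu k) j = 0"
    using kkt assms(3) unfolding projected_KKT_def x by blast
  then show ?thesis
    using assms(3) by (simp add: r Vt_mult_def inner_diff_right inner_add_right)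
qed

lemma basis_vec_orthogonal:
  assumes "ResQPASS A b l u y x lam mu r" and "is_iteration r k"
    and "i \<in> {1..k}" and "j \<in> {1..k}" and "i < j"
  shows "basis_vec r i \<bullet> basis_vec r j = 0"
proof -
  have "is_iteration r (j - 1)"
    using assms(2,4) by (auto simp: is_iteration_def)
  moreover have "i \<in> {1..j - 1}"
    using assms(3,5) by auto
  ultimately have "basis_vec r i \<bullet> r (j - 1) = 0"
    using basis_vec_orthogonal_residual[OF assms(1)] by blast
  then show ?thesis
    by (simp add: basis_vec_def[of r j])
qed

lemma norm_basis_vec:
  assumes "is_iteration r k" and "j \<in> {1..k}"
  shows "norm (basis_vec r j) = 1"
  using assms by (auto simp: is_iteration_def basis_vec_def)

text \<open>
  A column that occurred twice would be orthogonal to itself, contradicting norm 1; so the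
  columns, collected in a set, still number \<open>k\<close>.
\<close>

lemma V_columns_independent:
  assumes "ResQPASS A b l u y x lam mu r" and "is_iteration r k"
  shows "independent (V_columns r k)" and "card (V_columns r k) = k"
proof -
  have orth: "basis_vec r i \<bullet> basis_vec r j = 0"
    if "i \<in> {1..k}" "j \<in> {1..k}" "i \<noteq> j" for i j
    using that basis_vec_orthogonal[OF assms, of i j] basis_vec_orthogonal[OF assms, of j i]
    by (cases "i < j") (auto simp: inner_commute)
  have nonzero: "basis_vec r j \<noteq> 0" if "j \<in> {1..k}" for j
    using norm_basis_vec[OF assms(2) that] by auto
  have "inj_on (basis_vec r) {1..k}"
  proof (rule inj_onI, rule ccontr)
    fix i j
    assume "i \<in> {1..k}" "j \<in> {1..k}" "basis_vec r i = basis_vec r j" "i \<noteq> j"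
    then show False
      using orth[of i j] nonzero[of j] by simp
  qed
  then show "card (V_columns r k) = k"
    by (simp add: V_columns_def card_image)
  have "pairwise orthogonal (V_columns r k)"
    unfolding pairwise_def orthogonal_def V_columns_def using orth by fastforce
  moreover have "0 \<notin> V_columns r k"
    using nonzero by (force simp: V_columns_def)
  ultimately show "independent (V_columns r k)"
    by (rule pairwise_orthogonal_independent)
qed

lemma span_V_columns_full:
  fixes r :: "nat \<Rightarrow> real ^ 'n"
  assumes "ResQPASS A b l u y x lam mu r" and "is_iteration r CARD('n)"
  shows "span (V_columns r CARD('n)) = UNIV"
proof -
  have "UNIV \<subseteq> span (V_columns r CARD('n))"
    by (rule card_ge_dim_independent) (simp_all add: V_columns_independent[OF assms])
  then show ?thesis
    by blast
qed

theorem lemma2p6: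
  fixes A :: "real ^ 'n ^ 'm" and b :: "real ^ 'm" and l u :: "real ^ 'n"
    and y :: "nat \<Rightarrow> nat \<Rightarrow> real" and x lam mu r :: "nat \<Rightarrow> real ^ 'n"
  assumes "l \<le> 0" and "0 \<le> u"
    and "ResQPASS A b l u y x lam mu r"
  shows "\<exists>k0. 0 < k0 \<and> k0 \<le> CARD('n) \<and>
    (\<forall>k\<ge>k0. is_iteration r k \<longrightarrow>
      - lam k + mu k \<in> span (V_columns r k0 \<union> (\<lambda>w. (transpose A ** A) *v w) ` V_columns r (k0 - 1)))"
proof (intro exI conjI allI impI)
  show "0 < CARD('n)" and "CARD('n) \<le> CARD('n)"
    by simp_all
next
  fix k
  assume "CARD('n) \<le> k" and "is_iteration r k"
  then have "is_iteration r CARD('n)"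
    by (simp add: is_iteration_def)
  then have "- lam k + mu k \<in> span (V_columns r CARD('n))"
    using span_V_columns_full[OF assms(3)] by simp
  then show "- lam k + mu k \<in> span (V_columns r CARD('n)
      \<union> (\<lambda>w. (transpose A ** A) *v w) ` V_columns r (CARD('n) - 1))"
    using span_mono[OF Un_upper1] by blast
qed

end
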